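(* The $(\mathfrak{d}(\mathrm{cf}(\kappa)),\infty,<\kappa)$-distributive law fails for $\mathbb{P}$; that is, there are maximal antichains $\{\mathcal{A}_\gamma:\gamma<\mathfrak{d}(\mathrm{cf}(\kappa))\}$ of $\mathbb{P}$ such that for any choice of subsets $\mathcal{B}_\gamma\subseteq\mathcal{A}_\gamma$ with $|\mathcal{B}_\gamma|<\kappa$, there is no nonzero element of the regular open completion $\mathbb{B}$ of $\mathbb{P}$ lying below $\bigvee\mathcal{B}_\gamma$ for every $\gamma$.
   Context: $\kappa$ is a singular cardinal (of arbitrary cofinality) and $\langle \kappa_\alpha:\alpha<\mathrm{cf}(\kappa)\rangle$ is a strictly increasing sequence of regular cardinals with supremum $\kappa$ such that $\mathrm{cf}(\kappa)<\kappa_\alpha<\kappa$ for all $\alpha$. Standing assumption: $\mu^{\mathrm{cf}(\kappa)}<\kappa$ for every cardinal $\mu<\kappa$. Let $N$ be the set of functions $t$ with $\mathrm{dom}(t)$ an ordinal $<\mathrm{cf}(\kappa)$ and $t(\alpha)<\kappa_\alpha$ for all $\alpha\in\mathrm{dom}(t)$, and $X$ the set of functions $f$ with domain $\mathrm{cf}(\kappa)$ and $f(\alpha)<\kappa_\alpha$. A tree is a subset $T\subseteq N$ closed under initial segments; $[T]=\{f\in X: f\restriction\alpha\in T\ \forall\alpha<\mathrm{cf}(\kappa)\}$; $\mathrm{Succ}_T(t)$ is the set of one-point extensions of $t$ in $T$. $T$ is suitable if it is nonempty, every $t\in T$ has an extension in $[T]$, and every maximal element of $T\cup[T]$ under extension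 lies in $[T]$. $T$ is perfect if it is suitable and for every $\alpha<\mathrm{cf}(\kappa)$ and $t\in T$ there is $t'\in T$ extending $t$ with $|\mathrm{Succ}_T(t')|\ge\kappa_\alpha$. $\mathbb{P}$ is the set of perfect trees ordered by inclusion. For $f,g:\mathrm{cf}(\kappa)\to\mathrm{cf}(\kappa)$, $f\le^* g$ means $\{\alpha: f(\alpha)>g(\alpha)\}$ is bounded in $\mathrm{cf}(\kappa)$; $\mathfrak{d}(\mathrm{cf}(\kappa))$ is the least size of a family of functions $\mathrm{cf}(\kappa)\to\mathrm{cf}(\kappa)$ such that every such function is $\le^*$ some member of the family. *)

theory Defs
  imports "HOL-Analysis.Abstract_Topology"
begin

unbundle cardinal_syntax

section \<open>Ordinals below a cardinal\<close>

text \<open>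
  A cardinal \<open>\<kappa>\<close> is a relation satisfying \<^const>\<open>Card_order\<close>. The ordinals below \<open>\<kappa>\<close> are the
  elements of \<open>Field \<kappa>\<close>, and an ordinal \<open>a < \<kappa>\<close>, viewed as the set of its predecessors, is
  \<open>underS \<kappa> a\<close>; so \<open>b < a\<close> is written \<open>b \<in> underS \<kappa> a\<close>.
\<close>

definition seg :: "'a rel \<Rightarrow> 'a \<Rightarrow> 'a rel" where
  "seg \<kappa> a = Restr \<kappa> (underS \<kappa> a)"

definition is_regular_cardinal :: "'a rel \<Rightarrow> bool" where
  "is_regular_cardinal \<mu> \<longleftrightarrow> Cinfinite \<mu> \<and> regularCard \<mu>"

definition is_singular_cardinal :: "'a rel \<Rightarrow> bool" where
  "is_singular_cardinal \<mu> \<longleftrightarrow> Cinfinite \<mu> \<and> \<not> regularCard \<mu>"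

text \<open>
  The cofinality, as the least ordinal that is the domain of a cofinal map into \<open>\<kappa>\<close>. It is looked
  for among the ordinals below \<open>\<kappa>\<close>, so the definition is meaningful only for singular \<open>\<kappa>\<close>.
\<close>

definition cof :: "'a rel \<Rightarrow> 'a" where
  "cof \<kappa> = wo_rel.minim \<kappa>
     {c \<in> Field \<kappa>. \<exists>f. f ` underS \<kappa> c \<subseteq> Field \<kappa> \<and> cofinal (f ` underS \<kappa> c) \<kappa>}"

lemma cof_exists:
  assumes "is_singular_cardinal \<kappa>"
  shows "\<exists>c \<in> Field \<kappa>. \<exists>f. f ` underS \<kappa> c \<subseteq> Field \<kappa> \<and> cofinal (f ` underS \<kappa> c) \<kappa>"
proof -
  from assms have C: "Card_order \<kappa>" and "\<not> regularCard \<kappa>"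
    unfolding is_singular_cardinal_def by auto
  then obtain K where K: "K \<subseteq> Field \<kappa>" "cofinal K \<kappa>" "\<not> |K| =o \<kappa>"
    unfolding regularCard_def by blast
  have "|K| \<le>o \<kappa>"
    using K(1) C card_of_mono1 card_of_Field_ordIso ordLeq_ordIso_trans by blast
  with K(3) have "|K| <o \<kappa>"
    using ordLeq_iff_ordLess_or_ordIso by blast
  moreover have "Well_order \<kappa>" "Well_order |K|"
    using C card_order_on_well_order_on card_of_Well_order by auto
  ultimately obtain c where c: "c \<in> Field \<kappa>" "|K| =o Restr \<kappa> (underS \<kappa> c)"
    using ordLess_iff_ordIso_Restr by blast
  have fld: "Field (Restr \<kappa> (underS \<kappa> c)) = underS \<kappa> c"
    using \<open>Well_order \<kappa>\<close>
    by (intro Refl_Field_Restr2) (auto simp: order_on_defs underS_def Field_def)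
  have "|K| =o |underS \<kappa> c|"
    using card_of_cong[OF c(2)] fld by (simp add: Field_card_of)
  then obtain f where "bij_betw f (underS \<kappa> c) K"
    using card_of_ordIso ordIso_symmetric by blast
  then have "f ` underS \<kappa> c = K"
    by (simp add: bij_betw_def)
  with K c(1) show ?thesis by auto
qed

lemma cof_in_Field:
  assumes "is_singular_cardinal \<kappa>"
  shows "cof \<kappa> \<in> Field \<kappa>"
    and "\<exists>f. f ` underS \<kappa> (cof \<kappa>) \<subseteq> Field \<kappa> \<and> cofinal (f ` underS \<kappa> (cof \<kappa>)) \<kappa>"
proof -
  let ?S = "{c \<in> Field \<kappa>. \<exists>f. f ` underS \<kappa> c \<subseteq> Field \<kappa> \<and> cofinal (f ` underS \<kappa> c) \<kappa>}"
  have "Card_order \<kappa>"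
    using assms unfolding is_singular_cardinal_def by auto
  then have "wo_rel \<kappa>"
    unfolding wo_rel_def using card_order_on_well_order_on by blast
  moreover have "?S \<subseteq> Field \<kappa>" "?S \<noteq> {}"
    using cof_exists[OF assms] by auto
  ultimately have "wo_rel.minim \<kappa> ?S \<in> ?S"
    by (rule wo_rel.minim_in)
  then show "cof \<kappa> \<in> Field \<kappa>"
    and "\<exists>f. f ` underS \<kappa> (cof \<kappa>) \<subseteq> Field \<kappa> \<and> cofinal (f ` underS \<kappa> (cof \<kappa>)) \<kappa>"
    unfolding cof_def by auto
qed

definition approximating_sequence :: "'a rel \<Rightarrow> ('a \<Rightarrow> 'a) \<Rightarrow> bool" where
  "approximating_sequence \<kappa> k \<longleftrightarrow>
     (\<forall>\<alpha> \<in> underS \<kappa> (cof \<kappa>).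
        k \<alpha> \<in> Field \<kappa> \<and> cof \<kappa> \<in> underS \<kappa> (k \<alpha>) \<and> is_regular_cardinal (seg \<kappa> (k \<alpha>))) \<and>
     (\<forall>\<beta> \<in> underS \<kappa> (cof \<kappa>). \<forall>\<alpha> \<in> underS \<kappa> \<beta>. k \<alpha> \<in> underS \<kappa> (k \<beta>)) \<and>
     cofinal (k ` underS \<kappa> (cof \<kappa>)) \<kappa>"

section \<open>Trees\<close>

text \<open>
  Functions whose domain is an ordinal are partial maps; extension is \<^const>\<open>map_le\<close>, and
  the restriction of \<open>f\<close> to the ordinal \<open>\<alpha>\<close> is \<open>f |` underS \<kappa> \<alpha>\<close>.
\<close>

definition nodes :: "'a rel \<Rightarrow> ('a \<Rightarrow> 'a) \<Rightarrow> ('a \<rightharpoonup> 'a) set" where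
  "nodes \<kappa> k = {t. (\<exists>\<delta> \<in> underS \<kappa> (cof \<kappa>). dom t = underS \<kappa> \<delta>) \<and>
                   (\<forall>\<alpha> \<in> dom t. the (t \<alpha>) \<in> underS \<kappa> (k \<alpha>))}"

definition full_functions :: "'a rel \<Rightarrow> ('a \<Rightarrow> 'a) \<Rightarrow> ('a \<rightharpoonup> 'a) set" where
  "full_functions \<kappa> k = {f. dom f = underS \<kappa> (cof \<kappa>) \<and>
                            (\<forall>\<alpha> \<in> dom f. the (f \<alpha>) \<in> underS \<kappa> (k \<alpha>))}"

definition is_tree :: "'a rel \<Rightarrow> ('a \<Rightarrow> 'a) \<Rightarrow> ('a \<rightharpoonup> 'a) set \<Rightarrow> bool" where
  "is_tree \<kappa> k T \<longleftrightarrow> T \<subseteq> nodes \<kappa> k \<and> (\<forall>t \<in> T. \<forall>s \<in> nodes \<kappa> k. s \<subseteq>\<^sub>m t \<longrightarrow> s \<in> T)"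

definition body :: "'a rel \<Rightarrow> ('a \<Rightarrow> 'a) \<Rightarrow> ('a \<rightharpoonup> 'a) set \<Rightarrow> ('a \<rightharpoonup> 'a) set" where
  "body \<kappa> k T = {f \<in> full_functions \<kappa> k. \<forall>\<alpha> \<in> underS \<kappa> (cof \<kappa>). f |` underS \<kappa> \<alpha> \<in> T}"

text \<open>
  Since the domain of a member of \<open>T\<close> is an ordinal, the new point \<open>\<alpha>\<close> below is
  necessarily \<open>dom t\<close>.
\<close>

definition Succs :: "('a \<rightharpoonup> 'a) set \<Rightarrow> ('a \<rightharpoonup> 'a) \<Rightarrow> ('a \<rightharpoonup> 'a) set" where
  "Succs T t = {s \<in> T. \<exists>\<alpha> v. \<alpha> \<notin> dom t \<and> s = t(\<alpha> \<mapsto> v)}"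

definition suitable :: "'a rel \<Rightarrow> ('a \<Rightarrow> 'a) \<Rightarrow> ('a \<rightharpoonup> 'a) set \<Rightarrow> bool" where
  "suitable \<kappa> k T \<longleftrightarrow> is_tree \<kappa> k T \<and> T \<noteq> {} \<and>
     (\<forall>t \<in> T. \<exists>f \<in> body \<kappa> k T. t \<subseteq>\<^sub>m f) \<and>
     (\<forall>m \<in> T \<union> body \<kappa> k T. (\<forall>s \<in> T \<union> body \<kappa> k T. m \<subseteq>\<^sub>m s \<longrightarrow> s = m) \<longrightarrow> m \<in> body \<kappa> k T)"

definition perfect_tree :: "'a rel \<Rightarrow> ('a \<Rightarrow> 'a) \<Rightarrow> ('a \<rightharpoonup> 'a) set \<Rightarrow> bool" where
  "perfect_tree \<kappa> k T \<longleftrightarrow> suitable \<kappa> k T \<and>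
     (\<forall>\<alpha> \<in> underS \<kappa> (cof \<kappa>). \<forall>t \<in> T. \<exists>t' \<in> T. t \<subseteq>\<^sub>m t' \<and>
        |underS \<kappa> (k \<alpha>)| \<le>o |Succs T t'| )"

definition perfect_trees :: "'a rel \<Rightarrow> ('a \<Rightarrow> 'a) \<Rightarrow> ('a \<rightharpoonup> 'a) set set" where
  "perfect_trees \<kappa> k = {T. perfect_tree \<kappa> k T}"

section \<open>The dominating number\<close>

definition le_star :: "'a rel \<Rightarrow> ('a \<Rightarrow> 'a) \<Rightarrow> ('a \<Rightarrow> 'a) \<Rightarrow> bool" where
  "le_star \<kappa> f g \<longleftrightarrow>
     (\<exists>\<beta> \<in> underS \<kappa> (cof \<kappa>). \<forall>\<alpha> \<in> underS \<kappa> (cof \<kappa>). g \<alpha> \<in> underS \<kappa> (f \<alpha>) \<longrightarrow> \<alpha> \<in> underS \<kappa> \<beta>)"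

definition dominating_family :: "'a rel \<Rightarrow> ('a \<Rightarrow> 'a) set \<Rightarrow> bool" where
  "dominating_family \<kappa> F \<longleftrightarrow>
     F \<subseteq> Func (underS \<kappa> (cof \<kappa>)) (underS \<kappa> (cof \<kappa>)) \<and>
     (\<forall>f \<in> Func (underS \<kappa> (cof \<kappa>)) (underS \<kappa> (cof \<kappa>)). \<exists>g \<in> F. le_star \<kappa> f g)"

text \<open>\<open>D\<close> is the cardinal \<open>\<dd>(cf(\<kappa>))\<close>; it may live on any type.\<close>

definition is_dominating_number :: "'a rel \<Rightarrow> 'd rel \<Rightarrow> bool" where
  "is_dominating_number \<kappa> D \<longleftrightarrow> Card_order D \<and>
     (\<exists>F. dominating_family \<kappa> F \<and> |F| =o D) \<and>
     (\<forall>F. dominating_family \<kappa> F \<longrightarrow> D \<le>o |F| )"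

lemma dominating_number_exists:
  assumes "is_singular_cardinal \<kappa>"
  shows "\<exists>D :: ('a \<Rightarrow> 'a) rel. is_dominating_number (\<kappa> :: 'a rel) D"
proof -
  let ?c = "underS \<kappa> (cof \<kappa>)"
  have irr: "x \<notin> underS \<kappa> x" for x
    by (simp add: underS_def)
  have ne: "?c \<noteq> {}"
  proof
    assume e: "?c = {}"
    obtain f where "cofinal (f ` ?c) \<kappa>"
      using cof_in_Field(2)[OF assms] by blast
    with e show False
      using cof_in_Field(1)[OF assms] by (auto simp: cofinal_def)
  qed
  then have "le_star \<kappa> f f" for f
    unfolding le_star_def using irr by blast
  then have "dominating_family \<kappa> (Func ?c ?c)"
    unfolding dominating_family_def by blast
  then have "\<exists>r \<in> {|F| | F. dominating_family \<kappa> F}. \<forall>r' \<in> {|F| | F. dominating_family \<kappa> F}. r \<le>o r'"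
    by (intro exists_minim_Card_order) (auto simp: card_of_Card_order)
  then obtain F where "dominating_family \<kappa> F" "\<forall>G. dominating_family \<kappa> G \<longrightarrow> |F| \<le>o |G|"
    by blast
  then have "is_dominating_number \<kappa> |F|"
    unfolding is_dominating_number_def using card_of_Card_order card_of_refl by blast
  then show ?thesis by blast
qed

section \<open>Antichains and the regular open completion of a poset\<close>

definition compatible_in :: "'b::order set \<Rightarrow> 'b \<Rightarrow> 'b \<Rightarrow> bool" where
  "compatible_in P p q \<longleftrightarrow> (\<exists>r \<in> P. r \<le> p \<and> r \<le> q)"

definition antichain_in :: "'b::order set \<Rightarrow> 'b set \<Rightarrow> bool" where
  "antichain_in P A \<longleftrightarrow> A \<subseteq> P \<and> (\<forall>p \<in> A. \<forall>q \<in> A. p \<noteq> q \<longrightarrow> \<not> compatible_in P p q)"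

definition maximal_antichain_in :: "'b::order set \<Rightarrow> 'b set \<Rightarrow> bool" where
  "maximal_antichain_in P A \<longleftrightarrow>
     antichain_in P A \<and> (\<forall>A'. antichain_in P A' \<and> A \<subseteq> A' \<longrightarrow> A' = A)"

definition down_topology :: "'b::order set \<Rightarrow> 'b topology" where
  "down_topology P = topology (\<lambda>U. U \<subseteq> P \<and> (\<forall>p \<in> U. \<forall>q \<in> P. q \<le> p \<longrightarrow> q \<in> U))"

lemma openin_down_topology:
  "openin (down_topology P) U \<longleftrightarrow> U \<subseteq> P \<and> (\<forall>p \<in> U. \<forall>q \<in> P. q \<le> p \<longrightarrow> q \<in> U)"
proof -
  have "istopology (\<lambda>U. U \<subseteq> P \<and> (\<forall>p \<in> U. \<forall>q \<in> P. q \<le> p \<longrightarrow> q \<in> U))"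
    unfolding istopology_def by blast
  then show ?thesis
    unfolding down_topology_def by (simp add: topology_inverse')
qed

definition regularize :: "'b::order set \<Rightarrow> 'b set \<Rightarrow> 'b set" where
  "regularize P U = down_topology P interior_of (down_topology P closure_of U)"

text \<open>
  The regular open completion is the family of regular open sets ordered by inclusion; its zero
  is the empty set. A condition \<open>p\<close> is identified with its image \<open>ro_embed P p\<close>.
\<close>

definition RO :: "'b::order set \<Rightarrow> 'b set set" where
  "RO P = {U. regularize P U = U}"

definition ro_embed :: "'b::order set \<Rightarrow> 'b \<Rightarrow> 'b set" where
  "ro_embed P p = regularize P {q \<in> P. q \<le> p}"

definition ro_Join :: "'b::order set \<Rightarrow> 'b set set \<Rightarrow> 'b set" where
  "ro_Join P \<S> = regularize P (\<Union>\<S>)"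

lemma regularize_mono: "U \<subseteq> V \<Longrightarrow> regularize P U \<subseteq> regularize P V"
  unfolding regularize_def by (intro interior_of_mono closure_of_mono)

lemma regularize_in_RO: "regularize P U \<in> RO P"
proof -
  let ?T = "down_topology P"
  let ?W = "?T interior_of (?T closure_of U)"
  have "?T closure_of ?W \<subseteq> ?T closure_of U"
    by (metis closure_of_closure_of closure_of_mono interior_of_subset)
  moreover have "?W \<subseteq> ?T closure_of ?W"
    by (meson closure_of_subset interior_of_subset_topspace)
  ultimately have "?T interior_of (?T closure_of ?W) = ?W"
    by (metis interior_of_interior_of interior_of_mono subset_antisym)
  then show ?thesis
    by (simp add: RO_def regularize_def)
qed

lemma ro_Join_is_lub:
  assumes "\<S> \<subseteq> RO P"
  shows "ro_Join P \<S> \<in> RO P"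
    and "\<And>S. S \<in> \<S> \<Longrightarrow> S \<subseteq> ro_Join P \<S>"
    and "\<And>V. V \<in> RO P \<Longrightarrow> (\<And>S. S \<in> \<S> \<Longrightarrow> S \<subseteq> V) \<Longrightarrow> ro_Join P \<S> \<subseteq> V"
proof -
  show "ro_Join P \<S> \<in> RO P"
    by (simp add: ro_Join_def regularize_in_RO)
  show "S \<subseteq> ro_Join P \<S>" if "S \<in> \<S>" for S
  proof -
    have "regularize P S = S" using that assms by (auto simp: RO_def)
    moreover have "regularize P S \<subseteq> regularize P (\<Union>\<S>)"
      by (rule regularize_mono) (use that in blast)
    ultimately show ?thesis by (simp add: ro_Join_def)
  qed
  show "ro_Join P \<S> \<subseteq> V" if "V \<in> RO P" and "\<And>S. S \<in> \<S> \<Longrightarrow> S \<subseteq> V" for V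
  proof -
    have "regularize P (\<Union>\<S>) \<subseteq> regularize P V"
      by (rule regularize_mono) (use that(2) in blast)
    then show ?thesis using that(1) by (simp add: ro_Join_def RO_def)
  qed
qed

end

theory Submission
  imports Defs
begin

text \<open>
  For \<open>f : cf(\<kappa>) \<rightarrow> cf(\<kappa>)\<close>, call a tree thin if for every \<open>\<beta>\<close> it has at most \<open>\<kappa>\<^sub>\<beta>\<close> nodes at level
  \<open>f(\<beta>)\<close>. Delaying the splitting shows that thin perfect trees are dense, so for each member \<open>f\<^sub>\<gamma>\<close> of
  a dominating family there is a maximal antichain \<open>\<A>\<^sub>\<gamma>\<close> of \<open>f\<^sub>\<gamma>\<close>-thin trees. If \<open>S\<close> lies below
  \<open>\<Or>\<B>\<^sub>\<gamma>\<close>, every node of \<open>S\<close> belongs to some tree in \<open>\<B>\<^sub>\<gamma>\<close>; when \<open>|\<B>\<^sub>\<gamma>| < \<kappa>\<close>, level \<open>f\<^sub>\<gamma>(\<beta>)\<close> of \<open>S\<close>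
  therefore has at most \<open>\<kappa>\<^sub>\<beta>\<close> nodes for all large \<open>\<beta>\<close>. But \<open>S\<close> is perfect, so it has more than
  \<open>\<kappa>\<^sub>\<beta>\<close> nodes at some level \<open>h(\<beta>)\<close>, which is impossible for an \<open>f\<^sub>\<gamma>\<close> dominating \<open>h\<close>.

  Limits of chains in a perfect tree need not belong to it, so the thin subtree is generated from
  branches of the given tree in \<open>\<omega>\<close> steps instead of by a fusion of length \<open>cf(\<kappa>)\<close>: each step adds,
  for every branch and every \<open>\<alpha>\<close>, branches through \<open>\<kappa>\<^sub>\<alpha>\<close> successors of a node above level \<open>g(\<alpha>)\<close>,
  where \<open>g\<close> is a suitable majorant of \<open>f\<close>.
\<close>

section \<open>Antichains and joins in a poset\<close>

lemma compatible_in_sym: "compatible_in P p q \<Longrightarrow> compatible_in P q p"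
  unfolding compatible_in_def by blast

lemma compatible_in_mono: "compatible_in P q r \<Longrightarrow> q \<le> p \<Longrightarrow> compatible_in P p r"
  unfolding compatible_in_def by (blast intro: order_trans)

text \<open>Zorn's lemma yields \<open>M\<close>, maximal among the antichains inside
  \<open>E\<close>. If a condition \<open>p\<close> could be added to \<open>M\<close>, then so
  could any \<open>q \<in> E\<close> below it, since incompatibility passes to stronger
  conditions.\<close>

lemma maximal_antichain_in_dense:
  fixes P :: "'b::order set"
  assumes "E \<subseteq> P" and dense: "\<And>p. p \<in> P \<Longrightarrow> \<exists>q\<in>E. q \<le> p"
  shows "\<exists>A\<subseteq>E. maximal_antichain_in P A"
proof -
  let ?C = "{A. A \<subseteq> E \<and> antichain_in P A}"
  have "\<exists>M\<in>?C. \<forall>X\<in>?C. M \<subseteq> X \<longrightarrow> X = M"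
  proof (rule subset_Zorn')
    fix C assume "subset.chain ?C C"
    then have sub: "\<And>A. A \<in> C \<Longrightarrow> A \<subseteq> E \<and> antichain_in P A"
      and chain: "\<And>A B. A \<in> C \<Longrightarrow> B \<in> C \<Longrightarrow> A \<subseteq> B \<or> B \<subseteq> A"
      by (auto simp: subset_chain_def)
    have "\<not> compatible_in P p q" if pq: "p \<in> \<Union>C" "q \<in> \<Union>C" "p \<noteq> q" for p q
    proof -
      obtain A B where "A \<in> C" "p \<in> A" "B \<in> C" "q \<in> B" using pq by blast
      then show ?thesis
        using sub[of A] sub[of B] chain[of A B] pq(3) unfolding antichain_in_def by blast
    qed
    moreover have "\<Union>C \<subseteq> P" "\<Union>C \<subseteq> E" using sub \<open>E \<subseteq> P\<close> by blast+
    ultimately show "\<Union>C \<in> ?C" by (simp add: antichain_in_def)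
  qed
  then obtain M where M: "M \<subseteq> E" "antichain_in P M"
    and max: "\<And>X. X \<subseteq> E \<Longrightarrow> antichain_in P X \<Longrightarrow> M \<subseteq> X \<Longrightarrow> X = M"
    by auto
  have "A = M" if A: "antichain_in P A" "M \<subseteq> A" for A
  proof (rule ccontr)
    assume "A \<noteq> M"
    then obtain p where p: "p \<in> A" "p \<notin> M" using \<open>M \<subseteq> A\<close> by blast
    then have "p \<in> P" using A by (auto simp: antichain_in_def)
    then obtain q where q: "q \<in> E" "q \<le> p" using dense by blast
    have incompat: "\<not> compatible_in P q r" "\<not> compatible_in P r q" if "r \<in> M" for r
    proof -
      have "r \<in> A" "p \<noteq> r" using A(2) p(2) that by auto
      then have *: "\<not> compatible_in P p r" using A(1) p(1) by (auto simp: antichain_in_def)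
      show "\<not> compatible_in P q r"
        using * compatible_in_mono[OF _ q(2)] by (rule contrapos_nn)
      then show "\<not> compatible_in P r q"
        using compatible_in_sym by (rule contrapos_nn)
    qed
    have "antichain_in P (insert q M)"
      using M q(1) \<open>E \<subseteq> P\<close> incompat unfolding antichain_in_def by blast
    \<comment> \<open>Once \<open>q\<close> is in \<open>M\<close>, \<open>incompat\<close> applies
      to \<open>r = q\<close>, although \<open>q\<close> is compatible with itself.\<close>
    then have "q \<in> M" using max[of "insert q M"] M(1) q(1) by blast
    moreover have "compatible_in P q q"
      using q(1) \<open>E \<subseteq> P\<close> unfolding compatible_in_def by blast
    ultimately show False using incompat by blast
  qed
  then show ?thesis using M unfolding maximal_antichain_in_def by blast
qed

text \<open>A point of \<open>regularize P U\<close> lies in the closure of \<open>U\<close>, so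
  each of its neighbourhoods meets \<open>U\<close>. This is applied twice: to the join, giving
  \<open>s \<le> q\<close> in some \<open>ro_embed P r\<close>, and then to
  \<open>ro_embed P r\<close>, giving a common lower bound of \<open>s\<close> and
  \<open>r\<close>.\<close>

lemma ro_below_Join_compatible:
  fixes P :: "'b::order set"
  assumes "p \<in> ro_Join P (ro_embed P ` B)" "q \<in> P" "q \<le> p"
  shows "\<exists>r\<in>B. compatible_in P q r"
proof -
  have meets: "\<exists>s\<in>U. s \<le> x" if "x \<in> regularize P U" "U \<subseteq> P" for x U
  proof -
    have x: "x \<in> down_topology P closure_of U"
      using that(1) subsetD[OF interior_of_subset] by (simp add: regularize_def)
    then have "x \<in> topspace (down_topology P)" by (simp add: in_closure_of)
    moreover have "topspace (down_topology P) \<subseteq> P"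
      by (metis openin_down_topology openin_topspace)
    ultimately have "x \<in> P" by blast
    \<comment> \<open>The set of conditions below \<open>x\<close> is the smallest neighbourhood of
      \<open>x\<close>.\<close>
    then have "openin (down_topology P) {y \<in> P. y \<le> x}"
      by (auto simp: openin_down_topology)
    then obtain s where "s \<in> U" "s \<in> {y \<in> P. y \<le> x}"
      using x \<open>x \<in> P\<close> unfolding in_closure_of by (metis (no_types, lifting) mem_Collect_eq order_refl)
    then show ?thesis by blast
  qed
  have open_reg: "openin (down_topology P) (regularize P U)" for U
    by (simp add: regularize_def)
  have "q \<in> regularize P (\<Union>(ro_embed P ` B))"
    using assms open_reg[of "\<Union>(ro_embed P ` B)"] by (auto simp: openin_down_topology ro_Join_def)
  moreover have "ro_embed P r \<subseteq> P" for r
    using open_reg[of "{q \<in> P. q \<le> r}"] by (simp add: openin_down_topology ro_embed_def)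
  ultimately obtain s r where s: "s \<le> q" "r \<in> B" "s \<in> ro_embed P r"
    using meets[of q "\<Union>(ro_embed P ` B)"] by blast
  obtain s' where "s' \<in> P" "s' \<le> r" "s' \<le> s"
    using meets[of s "{q \<in> P. q \<le> r}"] s(3) unfolding ro_embed_def by blast
  with s have "compatible_in P s r" by (auto simp: compatible_in_def)
  with s show ?thesis using compatible_in_mono by blast
qed

section \<open>Auxiliary facts on partial maps and cardinals\<close>

lemma map_le_restrict: "t \<subseteq>\<^sub>m f \<Longrightarrow> f |` dom t = t"
  by (auto simp: map_le_def restrict_map_def fun_eq_iff domIff)

lemma restrict_map_le: "f |` A \<subseteq>\<^sub>m f"
  by (auto simp: map_le_def restrict_map_def)

lemma restrict_map_mono: "A \<subseteq> B \<Longrightarrow> f |` A \<subseteq>\<^sub>m f |` B"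
  by (auto simp: map_le_def restrict_map_def)

lemma card_of_subset_image: "A \<subseteq> f ` B \<Longrightarrow> |A| \<le>o |B|"
  using card_of_mono1 card_of_image ordLeq_transitive by blast

lemma Succs_map_le: "s \<in> Succs T t \<Longrightarrow> t \<subseteq>\<^sub>m s"
  by (auto simp: Succs_def map_le_def split: if_splits)

section \<open>The order of the ordinals below cf(\<kappa>) and the sequence
  \<open>k\<close>\<close>

locale tree_forcing =
  fixes \<kappa> :: "'a rel" and k :: "'a \<Rightarrow> 'a"
  assumes singular: "is_singular_cardinal \<kappa>"
    and approx: "approximating_sequence \<kappa> k"
begin

abbreviation L :: "'a set" where "L \<equiv> underS \<kappa> (cof \<kappa>)"

lemma wo_rel: "wo_rel \<kappa>"
  using singular card_order_on_well_order_on
  unfolding is_singular_cardinal_def wo_rel_def by blast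

lemma underS_in_Field: "a \<in> underS \<kappa> b \<Longrightarrow> a \<in> Field \<kappa>"
  by (auto simp: underS_def Field_def)

lemma underS_trans: "a \<in> underS \<kappa> b \<Longrightarrow> b \<in> underS \<kappa> c \<Longrightarrow> a \<in> underS \<kappa> c"
  using wo_rel.TRANS[OF wo_rel] wo_rel.ANTISYM[OF wo_rel]
  unfolding underS_def trans_def antisym_def by blast

lemma underS_irrefl: "a \<notin> underS \<kappa> a"
  by (simp add: underS_def)

lemma underS_cases:
  assumes "a \<in> Field \<kappa>" "b \<in> Field \<kappa>"
  obtains "a \<in> underS \<kappa> b" | "a = b" | "b \<in> underS \<kappa> a"
  using wo_rel.TOTALS[OF wo_rel] assms unfolding underS_def by blast

lemma underS_mono: "a \<in> underS \<kappa> b \<Longrightarrow> underS \<kappa> a \<subseteq> underS \<kappa> b"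
  using underS_trans by blast

lemma underS_subset_iff:
  assumes "a \<in> Field \<kappa>" "b \<in> Field \<kappa>"
  shows "underS \<kappa> a \<subseteq> underS \<kappa> b \<longleftrightarrow> b \<notin> underS \<kappa> a"
  using assms underS_mono underS_irrefl by (metis underS_cases subset_refl subsetD)

lemma underS_linear:
  assumes "a \<in> Field \<kappa>" "b \<in> Field \<kappa>"
  shows "underS \<kappa> a \<subseteq> underS \<kappa> b \<or> underS \<kappa> b \<subseteq> underS \<kappa> a"
  using assms underS_mono by (metis underS_cases subset_refl)

lemma L_in_Field: "\<alpha> \<in> L \<Longrightarrow> \<alpha> \<in> Field \<kappa>"
  by (rule underS_in_Field)

lemma cof_Field: "cof \<kappa> \<in> Field \<kappa>"
  by (rule cof_in_Field(1)[OF singular])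

lemma k_Field: "\<alpha> \<in> L \<Longrightarrow> k \<alpha> \<in> Field \<kappa>"
  and cof_less_k: "\<alpha> \<in> L \<Longrightarrow> cof \<kappa> \<in> underS \<kappa> (k \<alpha>)"
  and regular_k: "\<alpha> \<in> L \<Longrightarrow> is_regular_cardinal (seg \<kappa> (k \<alpha>))"
  and k_less: "\<beta> \<in> L \<Longrightarrow> \<alpha> \<in> underS \<kappa> \<beta> \<Longrightarrow> k \<alpha> \<in> underS \<kappa> (k \<beta>)"
  using approx unfolding approximating_sequence_def by blast+

lemma k_cofinal:
  assumes "a \<in> Field \<kappa>"
  obtains \<alpha> where "\<alpha> \<in> L" "a \<in> underS \<kappa> (k \<alpha>)"
  using approx assms unfolding approximating_sequence_def cofinal_def underS_def by blast

text \<open>Some \<open>k \<beta>\<close> exceeds \<open>k \<alpha>\<close> by cofinality, and since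
  \<open>k\<close> is increasing this rules out \<beta> \<le> \<alpha>.\<close>

lemma L_limit:
  assumes "\<alpha> \<in> L"
  obtains \<beta> where "\<beta> \<in> L" "\<alpha> \<in> underS \<kappa> \<beta>"
proof -
  obtain \<beta> where \<beta>: "\<beta> \<in> L" "k \<alpha> \<in> underS \<kappa> (k \<beta>)"
    using k_cofinal[OF k_Field[OF assms]] .
  show ?thesis
    using L_in_Field[OF assms] L_in_Field[OF \<beta>(1)]
  proof (cases rule: underS_cases)
    case 1 then show ?thesis using \<beta> that by blast
  next
    case 2 then show ?thesis using \<beta> underS_irrefl by blast
  next
    case 3 then show ?thesis using \<beta> k_less[OF assms] underS_trans underS_irrefl by blast
  qed
qed

lemma L_nonempty: "L \<noteq> {}"
  using k_cofinal[OF cof_Field] by blast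

lemma L_max:
  assumes "\<alpha> \<in> L" "\<beta> \<in> L"
  obtains \<gamma> where "\<gamma> \<in> L" "underS \<kappa> \<alpha> \<subseteq> underS \<kappa> \<gamma>" "underS \<kappa> \<beta> \<subseteq> underS \<kappa> \<gamma>"
  using underS_linear[OF L_in_Field[OF assms(1)] L_in_Field[OF assms(2)]] assms by blast

lemma k_mono:
  assumes "\<alpha> \<in> L" "\<beta> \<in> L" "underS \<kappa> \<alpha> \<subseteq> underS \<kappa> \<beta>"
  shows "underS \<kappa> (k \<alpha>) \<subseteq> underS \<kappa> (k \<beta>)"
  using L_in_Field[OF assms(1)] L_in_Field[OF assms(2)]
proof (cases rule: underS_cases)
  case 1 then show ?thesis using k_less[OF assms(2)] underS_mono by blast
next
  case 3 then show ?thesis using assms underS_irrefl by blast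
qed simp

text \<open>This is the regularity of cf(\<kappa>). If \<open>f\<close> were unbounded on \<alpha>,
  then \<open>k \<circ> f\<close> would be a cofinal map into \<kappa> with domain \<alpha> <
  cf(\<kappa>), against the minimality in \<open>cof\<close>.\<close>

lemma L_regular:
  assumes "\<alpha> \<in> L" "f ` underS \<kappa> \<alpha> \<subseteq> L"
  shows "\<exists>\<mu>\<in>L. f ` underS \<kappa> \<alpha> \<subseteq> underS \<kappa> \<mu>"
proof (rule ccontr)
  assume "\<not> ?thesis"
  then have unbounded: "\<exists>\<beta>\<in>underS \<kappa> \<alpha>. f \<beta> \<notin> underS \<kappa> \<mu>" if "\<mu> \<in> L" for \<mu>
    using that by blast
  have "\<exists>\<beta>\<in>underS \<kappa> \<alpha>. a \<in> underS \<kappa> (k (f \<beta>))" if a: "a \<in> Field \<kappa>" for a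
  proof -
    obtain \<mu> where \<mu>: "\<mu> \<in> L" "a \<in> underS \<kappa> (k \<mu>)" using k_cofinal[OF a] .
    obtain \<beta> where \<beta>: "\<beta> \<in> underS \<kappa> \<alpha>" "f \<beta> \<notin> underS \<kappa> \<mu>" using unbounded[OF \<mu>(1)] by blast
    then have "f \<beta> \<in> L" using assms(2) by blast
    then have "underS \<kappa> (k \<mu>) \<subseteq> underS \<kappa> (k (f \<beta>))"
      using k_mono \<mu>(1) \<beta>(2) underS_subset_iff L_in_Field by blast
    then show ?thesis using \<mu>(2) \<beta>(1) by blast
  qed
  then have "cofinal ((k \<circ> f) ` underS \<kappa> \<alpha>) \<kappa>"
    unfolding cofinal_def underS_def by auto
  moreover have "(k \<circ> f) ` underS \<kappa> \<alpha> \<subseteq> Field \<kappa>" using assms(2) k_Field by auto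
  ultimately have "(cof \<kappa>, \<alpha>) \<in> \<kappa>"
    unfolding cof_def using L_in_Field[OF assms(1)]
    by (intro wo_rel.minim_least[OF wo_rel]) auto
  then show False
    using assms(1) wo_rel.ANTISYM[OF wo_rel] unfolding underS_def antisym_def by blast
qed

text \<open>By regularity, \<open>g \<alpha>\<close> can bound both \<alpha> and all values
  \<open>f \<beta>\<close> with \<beta> \<le> \<alpha>. The last clause is the contrapositive of
  that bound, the form in which the node count in \<open>thin_dense\<close> uses it.\<close>

lemma monotone_majorant:
  assumes "f ` L \<subseteq> L"
  obtains g where "g ` L \<subseteq> L" "\<And>\<alpha>. \<alpha> \<in> L \<Longrightarrow> underS \<kappa> \<alpha> \<subseteq> underS \<kappa> (g \<alpha>)"
    "\<And>\<alpha> \<beta>. \<alpha> \<in> L \<Longrightarrow> \<beta> \<in> L \<Longrightarrow> g \<alpha> \<in> underS \<kappa> (f \<beta>) \<Longrightarrow> \<alpha> \<in> underS \<kappa> \<beta>"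
proof -
  have "\<exists>\<mu>\<in>L. underS \<kappa> \<alpha> \<subseteq> underS \<kappa> \<mu> \<and>
          (\<forall>\<beta>\<in>L. \<mu> \<in> underS \<kappa> (f \<beta>) \<longrightarrow> \<alpha> \<in> underS \<kappa> \<beta>)" if \<alpha>: "\<alpha> \<in> L" for \<alpha>
  proof -
    \<comment> \<open>\<open>L_regular\<close> controls only the indices strictly below its
      argument; passing to a larger \<alpha>' includes the index \<alpha> itself.\<close>
    obtain \<alpha>' where \<alpha>': "\<alpha>' \<in> L" "\<alpha> \<in> underS \<kappa> \<alpha>'" using L_limit[OF \<alpha>] .
    moreover have "f ` underS \<kappa> \<alpha>' \<subseteq> L"
      using assms underS_mono[OF \<alpha>'(1)] by blast
    ultimately obtain \<nu> where \<nu>: "\<nu> \<in> L" "f ` underS \<kappa> \<alpha>' \<subseteq> underS \<kappa> \<nu>"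
      using L_regular by blast
    obtain \<mu> where \<mu>: "\<mu> \<in> L" "underS \<kappa> \<alpha> \<subseteq> underS \<kappa> \<mu>" "underS \<kappa> \<nu> \<subseteq> underS \<kappa> \<mu>"
      using L_max[OF \<alpha> \<nu>(1)] .
    have "\<alpha> \<in> underS \<kappa> \<beta>" if \<beta>: "\<beta> \<in> L" "\<mu> \<in> underS \<kappa> (f \<beta>)" for \<beta>
    proof (rule ccontr)
      assume "\<alpha> \<notin> underS \<kappa> \<beta>"
      then have "\<beta> \<in> underS \<kappa> \<alpha>'"
        using \<alpha>' underS_trans underS_cases[OF L_in_Field[OF \<alpha>] L_in_Field[OF \<beta>(1)]] by metis
      then have "f \<beta> \<in> underS \<kappa> \<mu>" using \<nu>(2) \<mu>(3) by blast
      then show False using \<beta>(2) underS_trans underS_irrefl by blast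
    qed
    with \<mu> show ?thesis by blast
  qed
  then obtain g where "\<forall>\<alpha>\<in>L. g \<alpha> \<in> L \<and> underS \<kappa> \<alpha> \<subseteq> underS \<kappa> (g \<alpha>) \<and>
          (\<forall>\<beta>\<in>L. g \<alpha> \<in> underS \<kappa> (f \<beta>) \<longrightarrow> \<alpha> \<in> underS \<kappa> \<beta>)" by metis
  then show ?thesis by (intro that[of g]) blast+
qed

section \<open>Cardinalities of the ordinals \<open>k \<alpha>\<close>\<close>

lemma Field_seg: "Field (seg \<kappa> a) = underS \<kappa> a"
  unfolding seg_def using wo_rel.REFL[OF wo_rel]
  by (intro Refl_Field_Restr2) (auto simp: underS_def Field_def)

lemma infinite_k: "\<alpha> \<in> L \<Longrightarrow> infinite (underS \<kappa> (k \<alpha>))"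
  using regular_k[of \<alpha>] unfolding is_regular_cardinal_def cinfinite_def Field_seg by blast

text \<open>As \<open>k \<beta>\<close> is a cardinal, its proper initial segment
  \<open>k \<alpha>\<close> is smaller in cardinality and not only in order type.\<close>

lemma card_k_less:
  assumes "\<beta> \<in> L" "\<alpha> \<in> underS \<kappa> \<beta>"
  shows "|underS \<kappa> (k \<alpha>)| <o |underS \<kappa> (k \<beta>)|"
proof -
  let ?r = "seg \<kappa> (k \<beta>)"
  have C: "Card_order ?r" using regular_k[OF assms(1)] unfolding is_regular_cardinal_def by blast
  have k: "k \<alpha> \<in> underS \<kappa> (k \<beta>)" using k_less[OF assms] .
  then have "underS ?r (k \<alpha>) = underS \<kappa> (k \<alpha>)"
    using underS_mono[OF k] unfolding seg_def underS_def by blast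
  moreover have "|underS ?r (k \<alpha>)| <o ?r"
    using card_of_underS[OF C] k Field_seg by blast
  moreover have "?r =o |underS \<kappa> (k \<beta>)|"
    using card_of_Field_ordIso[OF C] ordIso_symmetric unfolding Field_seg by blast
  ultimately show ?thesis using ordLess_ordIso_trans by metis
qed

lemma card_underS_le_k:
  assumes "\<alpha> \<in> L"
  shows "|underS \<kappa> \<alpha>| \<le>o |underS \<kappa> (k \<alpha>)|"
  using underS_mono[OF underS_trans[OF assms cof_less_k[OF assms]]] by (rule card_of_mono1)

text \<open>A cardinal below \<kappa> is isomorphic to a proper initial segment of \<kappa>, which
  the cofinal sequence \<open>k\<close> passes.\<close>

lemma small_le_k:
  assumes "|B| <o \<kappa>"
  obtains \<alpha> where "\<alpha> \<in> L" "|B| \<le>o |underS \<kappa> (k \<alpha>)|"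
proof -
  obtain c where c: "c \<in> Field \<kappa>" "|B| =o seg \<kappa> c"
    using assms wo_rel card_of_Well_order[of B] ordLess_iff_ordIso_Restr
    unfolding wo_rel_def seg_def by blast
  then have B: "|B| =o |underS \<kappa> c|"
    using card_of_cong[OF c(2)] by (simp add: Field_seg Field_card_of)
  obtain \<alpha> where \<alpha>: "\<alpha> \<in> L" "c \<in> underS \<kappa> (k \<alpha>)" using k_cofinal[OF c(1)] .
  have "|underS \<kappa> c| \<le>o |underS \<kappa> (k \<alpha>)|"
    using underS_mono[OF \<alpha>(2)] by (rule card_of_mono1)
  then show ?thesis using that \<alpha>(1) B ordIso_ordLeq_trans by blast
qed

section \<open>Levels, nodes and branches of trees\<close>

abbreviation level :: "('a \<rightharpoonup> 'a) set \<Rightarrow> 'a \<Rightarrow> ('a \<rightharpoonup> 'a) set" where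
  "level T \<delta> \<equiv> {t \<in> T. dom t = underS \<kappa> \<delta>}"

definition thin :: "('a \<Rightarrow> 'a) \<Rightarrow> ('a \<rightharpoonup> 'a) set \<Rightarrow> bool" where
  "thin f T \<longleftrightarrow> (\<forall>\<beta>\<in>L. |level T (f \<beta>)| \<le>o |underS \<kappa> (k \<beta>)| )"

text \<open>Working form of perfection. A maximal element lying below a branch equals that branch,
  which settles the clause of \<open>suitable\<close> on maximal elements.\<close>

lemma perfect_tree_iff:
  "perfect_tree \<kappa> k T \<longleftrightarrow> is_tree \<kappa> k T \<and> T \<noteq> {} \<and> (\<forall>t\<in>T. \<exists>f\<in>body \<kappa> k T. t \<subseteq>\<^sub>m f) \<and>
     (\<forall>\<alpha>\<in>L. \<forall>t\<in>T. \<exists>t'\<in>T. t \<subseteq>\<^sub>m t' \<and> |underS \<kappa> (k \<alpha>)| \<le>o |Succs T t'| )"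
proof -
  have "\<forall>m \<in> T \<union> body \<kappa> k T. (\<forall>s \<in> T \<union> body \<kappa> k T. m \<subseteq>\<^sub>m s \<longrightarrow> s = m) \<longrightarrow> m \<in> body \<kappa> k T"
    if "\<forall>t\<in>T. \<exists>f\<in>body \<kappa> k T. t \<subseteq>\<^sub>m f"
    using that by (metis UnE UnI2)
  then show ?thesis unfolding perfect_tree_def suitable_def by blast
qed

lemma nodes_dom:
  assumes "t \<in> nodes \<kappa> k"
  obtains \<delta> where "\<delta> \<in> L" "dom t = underS \<kappa> \<delta>"
  using assms unfolding nodes_def by blast

lemma body_dom: "f \<in> body \<kappa> k T \<Longrightarrow> dom f = L"
  by (simp add: body_def full_functions_def)

lemma body_restrict: "f \<in> body \<kappa> k T \<Longrightarrow> \<alpha> \<in> L \<Longrightarrow> f |` underS \<kappa> \<alpha> \<in> T"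
  by (simp add: body_def)

lemma dom_restrict_body:
  "f \<in> body \<kappa> k T \<Longrightarrow> \<alpha> \<in> L \<Longrightarrow> dom (f |` underS \<kappa> \<alpha>) = underS \<kappa> \<alpha>"
  using body_dom[of f T] underS_mono[of \<alpha> "cof \<kappa>"] by auto

text \<open>Both nodes are restrictions of \<open>x\<close> to ordinals, and ordinals are
  comparable. Here \<open>x\<close> may be a node or a branch.\<close>

lemma nodes_linear:
  assumes "s \<in> nodes \<kappa> k" "t \<in> nodes \<kappa> k" "s \<subseteq>\<^sub>m x" "t \<subseteq>\<^sub>m x"
  shows "s \<subseteq>\<^sub>m t \<or> t \<subseteq>\<^sub>m s"
proof -
  obtain \<delta> \<epsilon> where "\<delta> \<in> L" "dom s = underS \<kappa> \<delta>" "\<epsilon> \<in> L" "dom t = underS \<kappa> \<epsilon>"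
    using nodes_dom[OF assms(1)] nodes_dom[OF assms(2)] by metis
  then have "dom s \<subseteq> dom t \<or> dom t \<subseteq> dom s"
    using underS_linear L_in_Field by simp
  then show ?thesis
    using restrict_map_mono[of "dom s" "dom t" x] restrict_map_mono[of "dom t" "dom s" x]
    unfolding map_le_restrict[OF assms(3)] map_le_restrict[OF assms(4)] by blast
qed

section \<open>Cones: strengthening a tree to pass through a given node\<close>

definition cone :: "('a \<rightharpoonup> 'a) set \<Rightarrow> ('a \<rightharpoonup> 'a) \<Rightarrow> ('a \<rightharpoonup> 'a) set" where
  "cone T s = {t \<in> T. t \<subseteq>\<^sub>m s \<or> s \<subseteq>\<^sub>m t}"

text \<open>Every node of the cone has an extension in \<open>T\<close> above \<open>s\<close>, and
  all of \<open>T\<close> above \<open>s\<close> survives in the cone. Branches and splitting nodes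
  of \<open>T\<close> found above such an extension therefore serve for the cone.\<close>

lemma cone_perfect:
  assumes T: "perfect_tree \<kappa> k T" and s: "s \<in> T"
  shows "perfect_tree \<kappa> k (cone T s)"
proof -
  have nodes: "T \<subseteq> nodes \<kappa> k"
    and closed: "\<And>t r. t \<in> T \<Longrightarrow> r \<in> nodes \<kappa> k \<Longrightarrow> r \<subseteq>\<^sub>m t \<Longrightarrow> r \<in> T"
    and ext: "\<And>t. t \<in> T \<Longrightarrow> \<exists>f\<in>body \<kappa> k T. t \<subseteq>\<^sub>m f"
    and split: "\<And>\<alpha> t. \<alpha> \<in> L \<Longrightarrow> t \<in> T \<Longrightarrow>
      \<exists>t'\<in>T. t \<subseteq>\<^sub>m t' \<and> |underS \<kappa> (k \<alpha>)| \<le>o |Succs T t'|"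
    using T unfolding perfect_tree_iff is_tree_def by blast+
  have above: "\<exists>t'\<in>T. t \<subseteq>\<^sub>m t' \<and> s \<subseteq>\<^sub>m t'" if "t \<in> cone T s" for t
    using that s unfolding cone_def by (metis (mono_tags, lifting) map_le_refl mem_Collect_eq)
  have "is_tree \<kappa> k (cone T s)"
    unfolding is_tree_def
  proof (intro conjI ballI impI)
    show "cone T s \<subseteq> nodes \<kappa> k" using nodes by (auto simp: cone_def)
    fix t r assume t: "t \<in> cone T s" and r: "r \<in> nodes \<kappa> k" "r \<subseteq>\<^sub>m t"
    obtain t' where t': "t' \<in> T" "t \<subseteq>\<^sub>m t'" "s \<subseteq>\<^sub>m t'" using above[OF t] by blast
    have "r \<subseteq>\<^sub>m t'" using r(2) t'(2) by (rule map_le_trans)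
    then have "r \<in> T" "r \<subseteq>\<^sub>m s \<or> s \<subseteq>\<^sub>m r"
      using closed[OF t'(1) r(1)] nodes_linear[OF r(1) _ _ t'(3)] s nodes by blast+
    then show "r \<in> cone T s" by (simp add: cone_def)
  qed
  moreover have "cone T s \<noteq> {}" using s by (auto simp: cone_def)
  moreover have "\<exists>f\<in>body \<kappa> k (cone T s). t \<subseteq>\<^sub>m f" if t: "t \<in> cone T s" for t
  proof -
    obtain t' where t': "t' \<in> T" "t \<subseteq>\<^sub>m t'" "s \<subseteq>\<^sub>m t'" using above[OF t] by blast
    obtain f where f: "f \<in> body \<kappa> k T" "t' \<subseteq>\<^sub>m f" using ext[OF t'(1)] by blast
    have sf: "s \<subseteq>\<^sub>m f" using t'(3) f(2) by (rule map_le_trans)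
    have "f |` underS \<kappa> \<alpha> \<in> cone T s" if "\<alpha> \<in> L" for \<alpha>
      using body_restrict[OF f(1) that] nodes_linear[OF _ _ restrict_map_le sf] nodes s
      unfolding cone_def by blast
    then have "f \<in> body \<kappa> k (cone T s)" using f(1) by (simp add: body_def)
    then show ?thesis using map_le_trans[OF t'(2) f(2)] by blast
  qed
  moreover have "\<exists>t'\<in>cone T s. t \<subseteq>\<^sub>m t' \<and> |underS \<kappa> (k \<alpha>)| \<le>o |Succs (cone T s) t'|"
    if \<alpha>: "\<alpha> \<in> L" and t: "t \<in> cone T s" for \<alpha> t
  proof -
    obtain t' where t': "t' \<in> T" "t \<subseteq>\<^sub>m t'" "s \<subseteq>\<^sub>m t'" using above[OF t] by blast
    obtain u where u: "u \<in> T" "t' \<subseteq>\<^sub>m u" "|underS \<kappa> (k \<alpha>)| \<le>o |Succs T u|"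
      using split[OF \<alpha> t'(1)] by blast
    have su: "s \<subseteq>\<^sub>m u" using t'(3) u(2) by (rule map_le_trans)
    have "Succs T u \<subseteq> Succs (cone T s) u"
    proof
      fix r assume r: "r \<in> Succs T u"
      then have "r \<in> T" "u \<subseteq>\<^sub>m r" using Succs_map_le[OF r] by (auto simp: Succs_def)
      then have "r \<in> cone T s" using map_le_trans[OF su] by (simp add: cone_def)
      then show "r \<in> Succs (cone T s) u" using r by (simp add: Succs_def)
    qed
    then have "|underS \<kappa> (k \<alpha>)| \<le>o |Succs (cone T s) u|"
      using u(3) card_of_mono1 ordLeq_transitive by blast
    moreover have "u \<in> cone T s" using u(1) su by (simp add: cone_def)
    ultimately show ?thesis using map_le_trans[OF t'(2) u(2)] by blast
  qed
  ultimately show ?thesis unfolding perfect_tree_iff by blast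
qed

text \<open>Restrict a branch of \<open>R\<close> to the length of \<open>s\<close>: the result is
  comparable with \<open>s\<close> and has the same domain, so it is \<open>s\<close>.\<close>

lemma perfect_subset_cone_mem:
  assumes "perfect_tree \<kappa> k R" "R \<subseteq> cone T s" "s \<in> nodes \<kappa> k"
  shows "s \<in> R"
proof -
  obtain f where f: "f \<in> body \<kappa> k R" using assms(1) unfolding perfect_tree_iff by blast
  obtain \<delta> where \<delta>: "\<delta> \<in> L" "dom s = underS \<kappa> \<delta>" using nodes_dom[OF assms(3)] .
  let ?r = "f |` underS \<kappa> \<delta>"
  have "?r \<in> R" using body_restrict[OF f \<delta>(1)] .
  moreover have "?r \<subseteq>\<^sub>m s \<or> s \<subseteq>\<^sub>m ?r" using \<open>?r \<in> R\<close> assms(2) unfolding cone_def by blast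
  moreover have "dom ?r = dom s" using dom_restrict_body[OF f \<delta>(1)] \<delta>(2) by simp
  ultimately show ?thesis
    by (metis map_le_antisym map_le_def)
qed

section \<open>Density of the thin perfect trees\<close>

lemma thin_dense:
  assumes T: "perfect_tree \<kappa> k T" and f: "f ` L \<subseteq> L"
  shows "\<exists>S\<subseteq>T. perfect_tree \<kappa> k S \<and> thin f S"
proof -
  obtain g where g: "g ` L \<subseteq> L" "\<And>\<alpha>. \<alpha> \<in> L \<Longrightarrow> underS \<kappa> \<alpha> \<subseteq> underS \<kappa> (g \<alpha>)"
    and gf: "\<And>\<alpha> \<beta>. \<alpha> \<in> L \<Longrightarrow> \<beta> \<in> L \<Longrightarrow> g \<alpha> \<in> underS \<kappa> (f \<beta>) \<Longrightarrow> \<alpha> \<in> underS \<kappa> \<beta>"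
    using monotone_majorant[OF f] by metis
  have gL: "g \<alpha> \<in> L" if "\<alpha> \<in> L" for \<alpha> using g(1) that by blast
  have fL: "f \<alpha> \<in> L" if "\<alpha> \<in> L" for \<alpha> using f that by blast
  have nodes: "T \<subseteq> nodes \<kappa> k" and "T \<noteq> {}"
    and ext: "\<forall>t\<in>T. \<exists>f\<in>body \<kappa> k T. t \<subseteq>\<^sub>m f"
    and split: "\<And>\<alpha> t. \<alpha> \<in> L \<Longrightarrow> t \<in> T \<Longrightarrow>
      \<exists>t'\<in>T. t \<subseteq>\<^sub>m t' \<and> |underS \<kappa> (k \<alpha>)| \<le>o |Succs T t'|"
    using T unfolding perfect_tree_iff is_tree_def by blast+
  obtain br where br: "\<And>t. t \<in> T \<Longrightarrow> br t \<in> body \<kappa> k T \<and> t \<subseteq>\<^sub>m br t"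
    using ext by metis
  \<comment> \<open>\<open>u\<close> will be a splitting node above \<open>t\<close>, and
    \<open>j\<close> an injective list of \<open>k \<alpha>\<close> many of its successors;
    \<open>e t \<alpha> v\<close> is then a branch through the successor listed at
    \<open>v\<close>.\<close>
  have "\<exists>u j. u \<in> T \<and> t \<subseteq>\<^sub>m u \<and> inj_on j (underS \<kappa> (k \<alpha>)) \<and> j ` underS \<kappa> (k \<alpha>) \<subseteq> Succs T u"
    if "\<alpha> \<in> L" "t \<in> T" for \<alpha> t
    using split[OF that] unfolding card_of_ordLeq[symmetric] by blast
  then obtain u j where uj: "\<And>\<alpha> t. \<alpha> \<in> L \<Longrightarrow> t \<in> T \<Longrightarrow> u \<alpha> t \<in> T \<and> t \<subseteq>\<^sub>m u \<alpha> t \<and>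
      inj_on (j \<alpha> t) (underS \<kappa> (k \<alpha>)) \<and> j \<alpha> t ` underS \<kappa> (k \<alpha>) \<subseteq> Succs T (u \<alpha> t)"
    by metis
  define e where "e t \<alpha> v = br (j \<alpha> t v)" for t \<alpha> v
  have succ: "j \<alpha> t v \<in> T" "u \<alpha> t \<subseteq>\<^sub>m j \<alpha> t v" "j \<alpha> t v \<in> Succs T (u \<alpha> t)"
    if "\<alpha> \<in> L" "t \<in> T" "v \<in> underS \<kappa> (k \<alpha>)" for \<alpha> t v
  proof -
    show *: "j \<alpha> t v \<in> Succs T (u \<alpha> t)" using uj[OF that(1,2)] that(3) by blast
    then show "j \<alpha> t v \<in> T" "u \<alpha> t \<subseteq>\<^sub>m j \<alpha> t v"
      using Succs_map_le[OF *] by (auto simp: Succs_def)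
  qed
  have e: "e t \<alpha> v \<in> body \<kappa> k T" "j \<alpha> t v \<subseteq>\<^sub>m e t \<alpha> v" "t \<subseteq>\<^sub>m e t \<alpha> v"
    if "\<alpha> \<in> L" "t \<in> T" "v \<in> underS \<kappa> (k \<alpha>)" for \<alpha> t v
  proof -
    show "e t \<alpha> v \<in> body \<kappa> k T" and *: "j \<alpha> t v \<subseteq>\<^sub>m e t \<alpha> v"
      using br succ(1)[OF that] by (auto simp: e_def)
    have "t \<subseteq>\<^sub>m u \<alpha> t" using uj[OF that(1,2)] by blast
    then show "t \<subseteq>\<^sub>m e t \<alpha> v"
      using map_le_trans succ(2)[OF that] * by blast
  qed
  obtain t0 where t0: "t0 \<in> T" using \<open>T \<noteq> {}\<close> by blast
  \<comment> \<open>A new branch follows \<open>b\<close> at least to level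
    \<open>g \<alpha>\<close> and depends on \<open>b\<close> only through its restriction to that
    level. Both facts are what makes the thinness count work.\<close>
  define F where "F = rec_nat {br t0}
    (\<lambda>_ X. X \<union> {e (b |` underS \<kappa> (g \<alpha>)) \<alpha> v | b \<alpha> v. b \<in> X \<and> \<alpha> \<in> L \<and> v \<in> underS \<kappa> (k \<alpha>)})"
  have F0: "F 0 = {br t0}" by (simp add: F_def)
  have F_Suc: "F (Suc n) = F n \<union>
      {e (b |` underS \<kappa> (g \<alpha>)) \<alpha> v | b \<alpha> v. b \<in> F n \<and> \<alpha> \<in> L \<and> v \<in> underS \<kappa> (k \<alpha>)}" for n
    by (simp add: F_def)
  have F_body: "F n \<subseteq> body \<kappa> k T" for n
  proof (induction n)
    case 0 show ?case using br[OF t0] by (simp add: F0)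
  next
    case (Suc n)
    have "e (b |` underS \<kappa> (g \<alpha>)) \<alpha> v \<in> body \<kappa> k T"
      if "b \<in> F n" "\<alpha> \<in> L" "v \<in> underS \<kappa> (k \<alpha>)" for b \<alpha> v
      using e(1)[OF that(2) body_restrict[OF _ gL[OF that(2)]] that(3)] Suc that(1) by blast
    then show ?case using Suc unfolding F_Suc by blast
  qed
  define B where "B = (\<Union>n. F n)"
  have B_body: "b \<in> body \<kappa> k T" if "b \<in> B" for b using that F_body by (auto simp: B_def)
  have B_e: "e (b |` underS \<kappa> (g \<alpha>)) \<alpha> v \<in> B"
    if b: "b \<in> B" and v: "\<alpha> \<in> L" "v \<in> underS \<kappa> (k \<alpha>)" for b \<alpha> v
  proof -
    obtain n where "b \<in> F n" using b by (auto simp: B_def)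
    then have "e (b |` underS \<kappa> (g \<alpha>)) \<alpha> v \<in> F (Suc n)" using v unfolding F_Suc by blast
    then show ?thesis by (auto simp: B_def)
  qed
  \<comment> \<open>All nodes are initial segments of members of \<open>B\<close>, so each node of
    \<open>S\<close> has a branch of \<open>S\<close> through it, whatever happens at limit
    levels.\<close>
  define S where "S = {b |` underS \<kappa> \<delta> | b \<delta>. b \<in> B \<and> \<delta> \<in> L}"
  have "S \<subseteq> T" using B_body body_restrict by (auto simp: S_def)
  have S_mem: "t \<in> S" if b: "b \<in> B" and t: "t \<in> nodes \<kappa> k" "t \<subseteq>\<^sub>m b" for t b
  proof -
    obtain \<delta> where "\<delta> \<in> L" "dom t = underS \<kappa> \<delta>" using nodes_dom[OF t(1)] .
    then have "t = b |` underS \<kappa> \<delta>" using map_le_restrict[OF t(2)] by simp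
    then show ?thesis using b \<open>\<delta> \<in> L\<close> by (auto simp: S_def)
  qed
  have "perfect_tree \<kappa> k S"
    unfolding perfect_tree_iff
  proof (intro conjI ballI)
    show "is_tree \<kappa> k S"
      unfolding is_tree_def
    proof (intro conjI ballI impI)
      show "S \<subseteq> nodes \<kappa> k" using \<open>S \<subseteq> T\<close> nodes by blast
      fix t s assume "t \<in> S" and s: "s \<in> nodes \<kappa> k" "s \<subseteq>\<^sub>m t"
      then obtain b \<delta> where "b \<in> B" "t = b |` underS \<kappa> \<delta>" by (auto simp: S_def)
      then show "s \<in> S" using S_mem[OF _ s(1)] map_le_trans[OF s(2)] restrict_map_le by blast
    qed
    have "br t0 \<in> B" using F0 by (auto simp: B_def intro!: exI[of _ 0])
    then show "S \<noteq> {}" using L_nonempty by (auto simp: S_def)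
    show "\<exists>f\<in>body \<kappa> k S. t \<subseteq>\<^sub>m f" if t: "t \<in> S" for t
    proof -
      obtain b \<delta> where b: "b \<in> B" "t = b |` underS \<kappa> \<delta>" using t by (auto simp: S_def)
      then have "b \<in> body \<kappa> k S" using B_body[OF b(1)] by (auto simp: body_def S_def)
      then show ?thesis using b(2) restrict_map_le by blast
    qed
    show "\<exists>t'\<in>S. t \<subseteq>\<^sub>m t' \<and> |underS \<kappa> (k \<alpha>)| \<le>o |Succs S t'|"
      if \<alpha>: "\<alpha> \<in> L" and t: "t \<in> S" for \<alpha> t
    proof -
      obtain b \<delta> where b: "b \<in> B" "\<delta> \<in> L" "t = b |` underS \<kappa> \<delta>" using t by (auto simp: S_def)
      \<comment> \<open>The index \<gamma> is above both: since \<delta> \<le> \<gamma> \<le>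
        \<open>g \<gamma>\<close>, the restriction of \<open>b\<close> to level
        \<open>g \<gamma>\<close> extends \<open>t\<close>, and since \<alpha> \<le> \<gamma>,
        splitting into \<open>k \<gamma>\<close> successors is enough.\<close>
      obtain \<gamma> where \<gamma>: "\<gamma> \<in> L" "underS \<kappa> \<alpha> \<subseteq> underS \<kappa> \<gamma>" "underS \<kappa> \<delta> \<subseteq> underS \<kappa> \<gamma>"
        using L_max[OF \<alpha> b(2)] .
      define s where "s = b |` underS \<kappa> (g \<gamma>)"
      have s: "s \<in> T" using body_restrict[OF B_body[OF b(1)] gL[OF \<gamma>(1)]] by (simp add: s_def)
      have "t \<subseteq>\<^sub>m s"
        using restrict_map_mono[of "underS \<kappa> \<delta>" "underS \<kappa> (g \<gamma>)" b] \<gamma>(3) g(2)[OF \<gamma>(1)]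
        by (simp add: b(3) s_def)
      then have tu: "t \<subseteq>\<^sub>m u \<gamma> s" using uj[OF \<gamma>(1) s] map_le_trans by blast
      have jS: "j \<gamma> s v \<in> S" if v: "v \<in> underS \<kappa> (k \<gamma>)" for v
        using S_mem[OF B_e[OF b(1) \<gamma>(1) v] _ e(2)[OF \<gamma>(1) s v, unfolded s_def]]
          succ(1)[OF \<gamma>(1) s v] nodes by (auto simp: s_def)
      \<comment> \<open>Any \<open>v\<close> will do: one branch in \<open>B\<close> through a
        successor of \<open>u \<gamma> s\<close> puts that node into \<open>S\<close>.\<close>
      obtain v where v: "v \<in> underS \<kappa> (k \<gamma>)" using infinite_k[OF \<gamma>(1)] by (metis equals0I finite.emptyI)
      have uS: "u \<gamma> s \<in> S"
        using S_mem[OF B_e[OF b(1) \<gamma>(1) v], of "u \<gamma> s"] nodes uj[OF \<gamma>(1) s]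
          map_le_trans[OF succ(2)[OF \<gamma>(1) s v] e(2)[OF \<gamma>(1) s v]] by (auto simp: s_def)
      have "j \<gamma> s ` underS \<kappa> (k \<gamma>) \<subseteq> Succs S (u \<gamma> s)"
        using jS succ(3)[OF \<gamma>(1) s] by (auto simp: Succs_def)
      then have "|underS \<kappa> (k \<gamma>)| \<le>o |Succs S (u \<gamma> s)|"
        using uj[OF \<gamma>(1) s] unfolding card_of_ordLeq[symmetric] by blast
      moreover have "|underS \<kappa> (k \<alpha>)| \<le>o |underS \<kappa> (k \<gamma>)|"
        using k_mono[OF \<alpha> \<gamma>(1,2)] by (rule card_of_mono1)
      ultimately show ?thesis using uS tu ordLeq_transitive by blast
    qed
  qed
  moreover have "thin f S"
    unfolding thin_def
  proof
    fix \<beta> assume \<beta>: "\<beta> \<in> L"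
    let ?U = "underS \<kappa> (f \<beta>)" and ?K = "underS \<kappa> (k \<beta>)"
    let ?res = "\<lambda>b. b |` underS \<kappa> (f \<beta>)"
    have K: "infinite ?K" using infinite_k[OF \<beta>] .
    text \<open>Successors chosen for an index \<open>\<alpha> \<ge> \<beta>\<close> branch off above level \<open>f \<beta>\<close>, so only the
      indices below \<open>\<beta>\<close> produce new nodes there.\<close>
    have "|?res ` F n| \<le>o |?K|" for n
    proof (induction n)
      case 0
      have "|{?res (br t0)}| \<le>o |?K|" using K by (intro card_of_singl_ordLeq) auto
      then show ?case by (simp add: F0)
    next
      case (Suc n)
      \<comment> \<open>If \<open>g \<alpha>\<close> is below \<open>f \<beta>\<close>, then
        \<open>b\<close> up to level \<open>g \<alpha>\<close> can be read off from
        \<open>?res b\<close>, while \<open>gf\<close> gives \<alpha> < \<beta> and hence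
        \<open>v \<in> ?K\<close>. So all new nodes at level \<open>f \<beta>\<close> lie in the
        image of \<open>?X\<close> under \<open>?h\<close>.\<close>
      let ?h = "\<lambda>(t, \<alpha>, v). ?res (e (t |` underS \<kappa> (g \<alpha>)) \<alpha> v)"
      let ?X = "?res ` F n \<times> underS \<kappa> \<beta> \<times> ?K"
      have "?res (e (b |` underS \<kappa> (g \<alpha>)) \<alpha> v) \<in> ?res ` F n \<union> ?h ` ?X"
        if that: "b \<in> F n" "\<alpha> \<in> L" "v \<in> underS \<kappa> (k \<alpha>)" for b \<alpha> v
      proof (cases "g \<alpha> \<in> ?U")
        case True
        then have \<alpha>: "\<alpha> \<in> underS \<kappa> \<beta>" using gf[OF that(2) \<beta>] by blast
        have "(?res b) |` underS \<kappa> (g \<alpha>) = b |` underS \<kappa> (g \<alpha>)"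
          using underS_mono[OF True] by (simp add: Int_absorb1)
        moreover have "v \<in> ?K" using that(3) underS_mono[OF k_less[OF \<beta> \<alpha>]] by blast
        ultimately show ?thesis using \<alpha> that(1)
          by (intro UnI2 image_eqI[of _ _ "(?res b, \<alpha>, v)"]) auto
      next
        case False
        then have sub: "?U \<subseteq> underS \<kappa> (g \<alpha>)"
          using underS_subset_iff L_in_Field fL[OF \<beta>] gL[OF that(2)] by blast
        have bT: "b \<in> body \<kappa> k T" using F_body that(1) by blast
        have "b |` underS \<kappa> (g \<alpha>) \<subseteq>\<^sub>m e (b |` underS \<kappa> (g \<alpha>)) \<alpha> v"
          using e(3)[OF that(2) body_restrict[OF bT gL[OF that(2)]] that(3)] .
        then have "?res b \<subseteq>\<^sub>m e (b |` underS \<kappa> (g \<alpha>)) \<alpha> v"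
          using restrict_map_mono[OF sub] map_le_trans by blast
        then have "?res (e (b |` underS \<kappa> (g \<alpha>)) \<alpha> v) = ?res b"
          using map_le_restrict dom_restrict_body[OF bT fL[OF \<beta>]] by fastforce
        then show ?thesis using that(1) by blast
      qed
      then have "?res ` F (Suc n) \<subseteq> ?res ` F n \<union> ?h ` ?X" unfolding F_Suc by blast
      \<comment> \<open>The factor \<open>underS \<kappa> \<beta>\<close> is small enough because
        \<beta> < cf(\<kappa>) < \<open>k \<beta>\<close>.\<close>
      moreover have "|?X| \<le>o |?K|"
        using K Suc card_underS_le_k[OF \<beta>] ordLeq_refl[OF card_of_Card_order]
        by (intro card_of_Sigma_ordLeq_infinite ballI)
      then have "|?h ` ?X| \<le>o |?K|" using card_of_image ordLeq_transitive by blast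
      then have "|?res ` F n \<union> ?h ` ?X| \<le>o |?K|"
        using K Suc card_of_Card_order
        by (intro card_of_Un_ordLeq_infinite_Field) (auto simp: Field_card_of)
      ultimately show ?case using card_of_mono1 ordLeq_transitive by blast
    qed
    \<comment> \<open>A union of countably many sets of size at most \<open>|?K|\<close> stays
      within that bound, as \<open>?K\<close> is infinite.\<close>
    then have "|\<Union>n. ?res ` F n| \<le>o |?K|"
      using K infinite_iff_card_of_nat[of ?K] by (intro card_of_UNION_ordLeq_infinite) auto
    moreover have "level S (f \<beta>) \<subseteq> (\<Union>n. ?res ` F n)"
    proof
      fix t assume t: "t \<in> level S (f \<beta>)"
      then obtain b \<delta> where b: "b \<in> B" "t = b |` underS \<kappa> \<delta>" by (auto simp: S_def)
      have "t \<subseteq>\<^sub>m b" using b(2) restrict_map_le by simp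
      then have "t = ?res b" using t map_le_restrict by fastforce
      then show "t \<in> (\<Union>n. ?res ` F n)" using b(1) by (auto simp: B_def)
    qed
    ultimately show "|level S (f \<beta>)| \<le>o |?K|" using card_of_mono1 ordLeq_transitive by blast
  qed
  ultimately show ?thesis using \<open>S \<subseteq> T\<close> by blast
qed

section \<open>Sizes of the levels of a perfect tree\<close>

text \<open>Domains of two successors are comparable ordinals, and each adds exactly one point to
  \<open>dom t\<close>; hence they coincide.\<close>

lemma Succs_subset_level:
  assumes "T \<subseteq> nodes \<kappa> k" "t \<in> T" "s \<in> Succs T t" "dom s = underS \<kappa> \<delta>" "\<delta> \<in> L"
  shows "Succs T t \<subseteq> level T \<delta>"
proof
  fix r assume r: "r \<in> Succs T t"
  then have rT: "r \<in> T" by (simp add: Succs_def)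
  then obtain \<epsilon> where \<epsilon>: "\<epsilon> \<in> L" "dom r = underS \<kappa> \<epsilon>" using nodes_dom assms(1) by blast
  have one_point: "\<exists>a. a \<notin> dom t \<and> dom q = insert a (dom t)" if "q \<in> Succs T t" for q
    using that by (auto simp: Succs_def)
  obtain a where a: "a \<notin> dom t" "dom r = insert a (dom t)" using one_point[OF r] by blast
  obtain b where b: "b \<notin> dom t" "dom s = insert b (dom t)" using one_point[OF assms(3)] by blast
  have "dom r \<subseteq> dom s \<or> dom s \<subseteq> dom r"
    using underS_linear[OF L_in_Field[OF \<epsilon>(1)] L_in_Field[OF assms(5)]] \<epsilon>(2) assms(4) by simp
  then have "dom r = dom s" using a b by auto
  then show "r \<in> level T \<delta>" using rT assms(4) by simp
qed

text \<open>Every node extends to a branch, so restriction maps the higher level onto the lower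
  one.\<close>

lemma card_level_mono:
  assumes T: "perfect_tree \<kappa> k T" and "\<delta> \<in> L" "\<epsilon> \<in> L" "underS \<kappa> \<delta> \<subseteq> underS \<kappa> \<epsilon>"
  shows "|level T \<delta>| \<le>o |level T \<epsilon>|"
proof (rule card_of_subset_image[where f = "\<lambda>t. t |` underS \<kappa> \<delta>"], rule subsetI)
  fix t assume t: "t \<in> level T \<delta>"
  then obtain f where f: "f \<in> body \<kappa> k T" "t \<subseteq>\<^sub>m f" using T unfolding perfect_tree_iff by blast
  have "t = (f |` underS \<kappa> \<epsilon>) |` underS \<kappa> \<delta>"
    using map_le_restrict[OF f(2)] t assms(4) by (simp add: Int_absorb1)
  moreover have "f |` underS \<kappa> \<epsilon> \<in> level T \<epsilon>"
    using body_restrict[OF f(1) assms(3)] dom_restrict_body[OF f(1) assms(3)] by simp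
  ultimately show "t \<in> (\<lambda>t. t |` underS \<kappa> \<delta>) ` level T \<epsilon>" by (rule image_eqI)
qed

lemma wide_levels:
  assumes T: "perfect_tree \<kappa> k T"
  shows "\<exists>h\<in>Func L L. \<forall>\<alpha>\<in>L. |underS \<kappa> (k \<alpha>)| <o |level T (h \<alpha>)|"
proof -
  have nodes: "T \<subseteq> nodes \<kappa> k" and "T \<noteq> {}"
    and split: "\<And>\<alpha> t. \<alpha> \<in> L \<Longrightarrow> t \<in> T \<Longrightarrow>
      \<exists>t'\<in>T. t \<subseteq>\<^sub>m t' \<and> |underS \<kappa> (k \<alpha>)| \<le>o |Succs T t'|"
    using T unfolding perfect_tree_iff is_tree_def by blast+
  have "\<exists>\<delta>\<in>L. |underS \<kappa> (k \<alpha>)| <o |level T \<delta>|" if \<alpha>: "\<alpha> \<in> L" for \<alpha>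
  proof -
    \<comment> \<open>Splitting into at least \<open>k \<beta>\<close> successors for some \<beta> >
      \<alpha> gives the strict inequality for \<open>k \<alpha>\<close>.\<close>
    obtain \<beta> where \<beta>: "\<beta> \<in> L" "\<alpha> \<in> underS \<kappa> \<beta>" using L_limit[OF \<alpha>] .
    obtain t where t: "t \<in> T" "|underS \<kappa> (k \<beta>)| \<le>o |Succs T t|"
      using split[OF \<beta>(1)] \<open>T \<noteq> {}\<close> by blast
    have less: "|underS \<kappa> (k \<alpha>)| <o |Succs T t|"
      using card_k_less[OF \<beta>] t(2) by (rule ordLess_ordLeq_trans)
    then have "Succs T t \<noteq> {}" using not_ordLess_ordLeq[OF less] card_of_empty by metis
    then obtain s where s: "s \<in> Succs T t" by blast
    then have "s \<in> T" by (simp add: Succs_def)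
    then obtain \<delta> where \<delta>: "\<delta> \<in> L" "dom s = underS \<kappa> \<delta>" using nodes_dom nodes by blast
    have "|Succs T t| \<le>o |level T \<delta>|"
      using Succs_subset_level[OF nodes t(1) s \<delta>(2,1)] by (rule card_of_mono1)
    then show ?thesis using less \<delta>(1) ordLess_ordLeq_trans by blast
  qed
  then have "\<forall>\<alpha>\<in>L. \<exists>\<delta>. \<delta> \<in> L \<and> |underS \<kappa> (k \<alpha>)| <o |level T \<delta>|" by blast
  from bchoice[OF this]
  obtain h where h: "\<forall>\<alpha>\<in>L. h \<alpha> \<in> L \<and> |underS \<kappa> (k \<alpha>)| <o |level T (h \<alpha>)|" ..
  show ?thesis
  \<comment> \<open>Members of \<open>Func L L\<close> must take the value \<open>undefined\<close>
    outside \<open>L\<close>.\<close>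
  proof (rule bexI[of _ "\<lambda>\<alpha>. if \<alpha> \<in> L then h \<alpha> else undefined"])
    show "(\<lambda>\<alpha>. if \<alpha> \<in> L then h \<alpha> else undefined) \<in> Func L L" using h by (simp add: Func_def)
  qed (use h in simp)
qed

section \<open>Trees below a join, and antichains of thin trees\<close>

text \<open>For a node \<open>s\<close> of \<open>S\<close>, the cone at \<open>s\<close> is a
  condition below \<open>S\<close>, hence compatible with some \<open>T \<in> B\<close>. A common
  lower bound contains \<open>s\<close>, and so does \<open>T\<close>.\<close>

lemma level_subset_Union:
  assumes S: "S \<in> perfect_trees \<kappa> k"
    and below: "S \<in> ro_Join (perfect_trees \<kappa> k) (ro_embed (perfect_trees \<kappa> k) ` B)"
  shows "level S \<delta> \<subseteq> (\<Union>T\<in>B. level T \<delta>)"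
proof
  fix s assume s: "s \<in> level S \<delta>"
  have P: "perfect_tree \<kappa> k S" using S by (simp add: perfect_trees_def)
  then have "s \<in> nodes \<kappa> k" using s unfolding perfect_tree_iff is_tree_def by blast
  have "cone S s \<in> perfect_trees \<kappa> k" using cone_perfect[OF P] s by (simp add: perfect_trees_def)
  moreover have "cone S s \<subseteq> S" by (auto simp: cone_def)
  ultimately obtain T where T: "T \<in> B" "compatible_in (perfect_trees \<kappa> k) (cone S s) T"
    using ro_below_Join_compatible[OF below] by blast
  then obtain R where "perfect_tree \<kappa> k R" "R \<subseteq> cone S s" "R \<subseteq> T"
    unfolding compatible_in_def perfect_trees_def by auto
  then have "s \<in> T" using perfect_subset_cone_mem \<open>s \<in> nodes \<kappa> k\<close> by blast
  then show "s \<in> (\<Union>T\<in>B. level T \<delta>)" using T(1) s by blast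
qed

lemma maximal_antichain_thin:
  assumes "f ` L \<subseteq> L"
  shows "\<exists>A. maximal_antichain_in (perfect_trees \<kappa> k) A \<and> (\<forall>T\<in>A. thin f T)"
proof -
  let ?E = "{T \<in> perfect_trees \<kappa> k. thin f T}"
  have "\<exists>A\<subseteq>?E. maximal_antichain_in (perfect_trees \<kappa> k) A"
  proof (rule maximal_antichain_in_dense)
    show "\<exists>S\<in>?E. S \<subseteq> T" if "T \<in> perfect_trees \<kappa> k" for T
    proof -
      have "perfect_tree \<kappa> k T" using that by (simp add: perfect_trees_def)
      then obtain S where "perfect_tree \<kappa> k S" "S \<subseteq> T" "thin f S"
        using thin_dense[OF _ assms] by blast
      then show ?thesis by (auto simp: perfect_trees_def)
    qed
  qed auto
  then obtain A where A: "A \<subseteq> ?E" "maximal_antichain_in (perfect_trees \<kappa> k) A" by metis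
  then have "\<forall>T\<in>A. thin f T" by auto
  with A(2) show ?thesis by (intro exI[of _ A] conjI)
qed

end

section \<open>Failure of the distributive law\<close>

theorem theorem4p6:
  fixes \<kappa> :: "'a rel" and k :: "'a \<Rightarrow> 'a" and D :: "'d rel"
  assumes "is_singular_cardinal \<kappa>"
    and "approximating_sequence \<kappa> k"
    and "\<forall>\<mu> :: 'a rel. Card_order \<mu> \<and> \<mu> <o \<kappa> \<longrightarrow> \<mu> ^c seg \<kappa> (cof \<kappa>) <o \<kappa>"
    and "is_dominating_number \<kappa> D"
  shows "\<exists>\<A> :: 'd \<Rightarrow> ('a \<rightharpoonup> 'a) set set.
           (\<forall>\<gamma> \<in> Field D. maximal_antichain_in (perfect_trees \<kappa> k) (\<A> \<gamma>)) \<and>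
           (\<forall>\<B> :: 'd \<Rightarrow> ('a \<rightharpoonup> 'a) set set.
              (\<forall>\<gamma> \<in> Field D. \<B> \<gamma> \<subseteq> \<A> \<gamma> \<and> |\<B> \<gamma>| <o \<kappa>) \<longrightarrow>
              \<not> (\<exists>b \<in> RO (perfect_trees \<kappa> k). b \<noteq> {} \<and>
                   (\<forall>\<gamma> \<in> Field D.
                      b \<subseteq> ro_Join (perfect_trees \<kappa> k) (ro_embed (perfect_trees \<kappa> k) ` \<B> \<gamma>))))"
proof -
  interpret tree_forcing \<kappa> k using assms by unfold_locales
  let ?P = "perfect_trees \<kappa> k"
  obtain F where F: "dominating_family \<kappa> F" "|F| =o D"
    using assms(4) unfolding is_dominating_number_def by blast
  then have "|F| =o |Field D|" using card_of_cong[OF F(2)] by (simp add: Field_card_of)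
  \<comment> \<open>\<open>D\<close> may live on any type, so the dominating family is re-indexed by
    \<open>Field D\<close>.\<close>
  then obtain \<phi> where \<phi>: "bij_betw \<phi> (Field D) F"
    using card_of_ordIso ordIso_symmetric by blast
  have FL: "f ` L \<subseteq> L" if "f \<in> F" for f
    using F(1) that unfolding dominating_family_def Func_def by blast
  have "\<forall>\<gamma>\<in>Field D. \<exists>A. maximal_antichain_in ?P A \<and> (\<forall>T\<in>A. thin (\<phi> \<gamma>) T)"
    using maximal_antichain_thin FL \<phi> bij_betwE by blast
  then obtain \<A> where \<A>: "\<forall>\<gamma>\<in>Field D. maximal_antichain_in ?P (\<A> \<gamma>) \<and> (\<forall>T\<in>\<A> \<gamma>. thin (\<phi> \<gamma>) T)"
    by metis
  have no_lower_bound: False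
    if small: "\<forall>\<gamma> \<in> Field D. \<B> \<gamma> \<subseteq> \<A> \<gamma> \<and> |\<B> \<gamma>| <o \<kappa>"
      and b: "b \<in> RO ?P" "b \<noteq> {}" "\<forall>\<gamma> \<in> Field D. b \<subseteq> ro_Join ?P (ro_embed ?P ` \<B> \<gamma>)" for \<B> b
  proof -
    \<comment> \<open>The elements of the regular open set \<open>b\<close> are themselves perfect
      trees, and any one of them belongs to all the joins.\<close>
    obtain S where S: "S \<in> b" using b(2) by blast
    have "openin (down_topology ?P) (regularize ?P b)" by (simp add: regularize_def)
    then have SP: "S \<in> ?P" using b(1) S by (auto simp: RO_def openin_down_topology)
    then have perf: "perfect_tree \<kappa> k S" by (simp add: perfect_trees_def)
    obtain h where h: "h \<in> Func L L" "\<And>\<alpha>. \<alpha> \<in> L \<Longrightarrow> |underS \<kappa> (k \<alpha>)| <o |level S (h \<alpha>)|"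
      using wide_levels[OF perf] by blast
    have hL: "h \<alpha> \<in> L" if "\<alpha> \<in> L" for \<alpha> using h(1) that by (simp add: Func_def)
    have "\<exists>f\<in>F. le_star \<kappa> h f" using F(1) h(1) by (simp add: dominating_family_def)
    then obtain f where f: "f \<in> F" "le_star \<kappa> h f" by blast
    obtain \<gamma> where \<gamma>: "\<gamma> \<in> Field D" "\<phi> \<gamma> = f"
      using f(1) \<phi> by (metis bij_betw_def image_iff)
    obtain \<beta> where \<beta>: "\<beta> \<in> L" "\<forall>\<alpha>\<in>L. f \<alpha> \<in> underS \<kappa> (h \<alpha>) \<longrightarrow> \<alpha> \<in> underS \<kappa> \<beta>"
      using f(2) unfolding le_star_def by blast
    have "|\<B> \<gamma>| <o \<kappa>" using small \<gamma>(1) by blast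
    then obtain \<beta>' where \<beta>': "\<beta>' \<in> L" "|\<B> \<gamma>| \<le>o |underS \<kappa> (k \<beta>')|"
      by (rule small_le_k)
    \<comment> \<open>Above \<beta> the function \<open>f\<close> dominates \<open>h\<close>, and
      above \<beta>' the size of \<open>\<B> \<gamma>\<close> is at most \<open>k \<alpha>\<close>;
      a single \<alpha> past both yields the contradiction.\<close>
    obtain \<alpha> where \<alpha>: "\<alpha> \<in> L" "underS \<kappa> \<beta> \<subseteq> underS \<kappa> \<alpha>" "underS \<kappa> \<beta>' \<subseteq> underS \<kappa> \<alpha>"
      using L_max[OF \<beta>(1) \<beta>'(1)] .
    have "f \<alpha> \<notin> underS \<kappa> (h \<alpha>)" using \<beta>(2) \<alpha> underS_irrefl by blast
    have fL: "f \<alpha> \<in> L" using FL[OF f(1)] \<alpha>(1) by blast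
    let ?K = "underS \<kappa> (k \<alpha>)"
    have "underS \<kappa> (h \<alpha>) \<subseteq> underS \<kappa> (f \<alpha>)"
      using \<open>f \<alpha> \<notin> underS \<kappa> (h \<alpha>)\<close> underS_subset_iff L_in_Field hL[OF \<alpha>(1)] fL by blast
    then have "|level S (h \<alpha>)| \<le>o |level S (f \<alpha>)|"
      using card_level_mono[OF perf hL[OF \<alpha>(1)] fL] by blast
    then have wide: "|?K| <o |level S (f \<alpha>)|"
      using h(2)[OF \<alpha>(1)] ordLess_ordLeq_trans by blast
    \<comment> \<open>A level with more than \<open>|?K|\<close> nodes is now covered by at most
      \<open>|?K|\<close> levels of thin trees, each of size at most \<open>|?K|\<close>.\<close>
    have "level S (f \<alpha>) \<subseteq> (\<Union>T\<in>\<B> \<gamma>. level T (f \<alpha>))"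
      using level_subset_Union[OF SP, of "\<B> \<gamma>"] S b(3) \<gamma>(1) by blast
    then have "|level S (f \<alpha>)| \<le>o |\<Union>T\<in>\<B> \<gamma>. level T (f \<alpha>)|" by (rule card_of_mono1)
    also have "|\<Union>T\<in>\<B> \<gamma>. level T (f \<alpha>)| \<le>o |?K|"
    proof (rule card_of_UNION_ordLeq_infinite)
      show "infinite ?K" using infinite_k[OF \<alpha>(1)] .
      show "|\<B> \<gamma>| \<le>o |?K|"
        using \<beta>'(2) card_of_mono1[OF k_mono[OF \<beta>'(1) \<alpha>(1,3)]] by (rule ordLeq_transitive)
      show "\<forall>T\<in>\<B> \<gamma>. |level T (f \<alpha>)| \<le>o |?K|"
        using \<A> small \<gamma> \<alpha>(1) unfolding thin_def by blast
    qed
    finally show False using not_ordLess_ordLeq[OF wide] by blast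
  qed
  show ?thesis
  proof (intro exI[of _ \<A>] conjI ballI allI impI notI)
    show "maximal_antichain_in ?P (\<A> \<gamma>)" if "\<gamma> \<in> Field D" for \<gamma> using \<A> that by blast
    show False
      if "\<forall>\<gamma> \<in> Field D. \<B> \<gamma> \<subseteq> \<A> \<gamma> \<and> |\<B> \<gamma>| <o \<kappa>"
        and "\<exists>b \<in> RO ?P. b \<noteq> {} \<and>
          (\<forall>\<gamma> \<in> Field D. b \<subseteq> ro_Join ?P (ro_embed ?P ` \<B> \<gamma>))" for \<B>
      using that(2) no_lower_bound[OF that(1)] by blast
  qed
qed

end
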